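(* Let $A$ and $B$ be arbitrary semigroups, and let $\varphi:A\to B$ be a mapping such that $\alpha_\varphi$ is a congruence on $B$. Define $P_A:A\to A\times B$ by $P_A(a)=(a,\varphi(a))$ and $P':A\to A/\theta_A^{*}\times B/\alpha_\varphi$ by $P'(a)=([a]_{\theta_A^{*}},[\varphi(a)]_{\alpha_\varphi})$. Then the triple $A\times B,\ A,\ A/\theta_A^{*}\times B/\alpha_\varphi$ is right regular with respect to the couple $(P_A,P')$.
   Context: A semigroup is a nonempty set with an associative multiplication; mappings are not assumed to be homomorphisms. For a semigroup $S$, a nonempty set $\Lambda$ and a mapping $P:\Lambda\to S$, let $\mathcal{M}(S;\Lambda;P)$ denote the semigroup on the set $S\times\Lambda$ with multiplication $(s,\lambda)(t,\mu)=(sP(\lambda)t,\mu)$. For a semigroup $S$, $\theta_S=\{(a,b)\in S\times S: xa=xb \text{ for all } x\in S\}$; this is a congruence on $S$. For a congruence $\varrho$ on $S$, the right colon congruence of $\varrho$ is the congruence $\varrho^{*}=\{(a,b)\in S\times S: (sa,sb)\in\varrho \text{ for all } s\in S\}$; $\theta_S^{*}$ denotes the right colon congruence of $\theta_S$. For semigroups $X,Y,Z$ and mappings $P:Y\to X$, $P':Y\to Z$, the triple $X,Y,Z$ is right regular with respect to the couple $(P,P')$ if $\mathcal{M}(X;Y;P)/\theta_{\mathcal{M}(X;Y;P)}\cong\mathcal{M}(Z;Y;P')$ as semigroups. For a mapping $\varphi:A\to B$ of a nonempty set $A$ into a semigroup $B$, $\alpha_\varphi=\{(b_1,b_2)\in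 B\times B: b\varphi(a)b_1=b\varphi(a)b_2 \text{ for all } b\in B,\ a\in A\}$, which is a right congruence on $B$. $[x]_{\alpha}$ denotes the $\alpha$-class of $x$; $A\times B$ is the direct product. *)

theory Defs
  imports "HOL-Algebra.Group"
begin

text \<open>
  Semigroups are carried by the record \<^typ>\<open>'a monoid\<close>, so that \<^const>\<open>hom\<close>, \<^const>\<open>is_iso\<close>
  and \<^const>\<open>DirProd\<close> apply.  The field \<^const>\<open>one\<close> is unconstrained: carriers, products and
  isomorphisms do not depend on it, and the structures built below leave it \<^const>\<open>undefined\<close>.
\<close>

locale nonempty_semigroup =
  fixes S (structure)
  assumes carrier_nonempty: "carrier S \<noteq> {}"
    and m_closed: "\<lbrakk>x \<in> carrier S; y \<in> carrier S\<rbrakk> \<Longrightarrow> x \<otimes> y \<in> carrier S"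
    and m_assoc: "\<lbrakk>x \<in> carrier S; y \<in> carrier S; z \<in> carrier S\<rbrakk>
      \<Longrightarrow> (x \<otimes> y) \<otimes> z = x \<otimes> (y \<otimes> z)"

definition sg_congruence :: "('a, 'm) monoid_scheme \<Rightarrow> ('a \<times> 'a) set \<Rightarrow> bool" where
  "sg_congruence S \<rho> \<longleftrightarrow> equiv (carrier S) \<rho> \<and>
     (\<forall>(a, b) \<in> \<rho>. \<forall>s \<in> carrier S.
        (s \<otimes>\<^bsub>S\<^esub> a, s \<otimes>\<^bsub>S\<^esub> b) \<in> \<rho> \<and> (a \<otimes>\<^bsub>S\<^esub> s, b \<otimes>\<^bsub>S\<^esub> s) \<in> \<rho>)"

text \<open>
  The product of two classes is the class of the product of any representatives; the union is
  over all representatives, which give the same class when \<open>\<rho>\<close> is a congruence.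
\<close>

definition sg_quotient ::
    "('a, 'm) monoid_scheme \<Rightarrow> ('a \<times> 'a) set \<Rightarrow> 'a set monoid" where
  "sg_quotient S \<rho> =
     \<lparr>carrier = carrier S // \<rho>,
      mult = (\<lambda>X Y. \<Union>x\<in>X. \<Union>y\<in>Y. \<rho> `` {x \<otimes>\<^bsub>S\<^esub> y}),
      one = undefined\<rparr>"

definition sandwich ::
    "('a, 'm) monoid_scheme \<Rightarrow> 'l set \<Rightarrow> ('l \<Rightarrow> 'a) \<Rightarrow> ('a \<times> 'l) monoid" where
  "sandwich S \<Lambda> P =
     \<lparr>carrier = carrier S \<times> \<Lambda>,
      mult = (\<lambda>(s, l) (t, m). (s \<otimes>\<^bsub>S\<^esub> P l \<otimes>\<^bsub>S\<^esub> t, m)),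
      one = undefined\<rparr>"

definition theta :: "('a, 'm) monoid_scheme \<Rightarrow> ('a \<times> 'a) set" where
  "theta S = {(a, b) \<in> carrier S \<times> carrier S.
     \<forall>x \<in> carrier S. x \<otimes>\<^bsub>S\<^esub> a = x \<otimes>\<^bsub>S\<^esub> b}"

definition right_colon ::
    "('a, 'm) monoid_scheme \<Rightarrow> ('a \<times> 'a) set \<Rightarrow> ('a \<times> 'a) set" where
  "right_colon S \<rho> = {(a, b) \<in> carrier S \<times> carrier S.
     \<forall>s \<in> carrier S. (s \<otimes>\<^bsub>S\<^esub> a, s \<otimes>\<^bsub>S\<^esub> b) \<in> \<rho>}"

definition alpha :: "'a set \<Rightarrow> ('b, 'm) monoid_scheme \<Rightarrow> ('a \<Rightarrow> 'b) \<Rightarrow> ('b \<times> 'b) set" where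
  "alpha A B \<phi> = {(b1, b2) \<in> carrier B \<times> carrier B.
     \<forall>b \<in> carrier B. \<forall>a \<in> A.
       b \<otimes>\<^bsub>B\<^esub> \<phi> a \<otimes>\<^bsub>B\<^esub> b1 = b \<otimes>\<^bsub>B\<^esub> \<phi> a \<otimes>\<^bsub>B\<^esub> b2}"

text \<open>
  The first two lines make explicit the typing presupposed by the notion: three semigroups and
  two mappings between their carriers.
\<close>

definition right_regular ::
    "('x, 'm) monoid_scheme \<Rightarrow> ('y, 'n) monoid_scheme \<Rightarrow> ('z, 'o) monoid_scheme
      \<Rightarrow> ('y \<Rightarrow> 'x) \<Rightarrow> ('y \<Rightarrow> 'z) \<Rightarrow> bool" where
  "right_regular X Y Z P P' \<longleftrightarrow>
     nonempty_semigroup X \<and> nonempty_semigroup Y \<and> nonempty_semigroup Z \<and>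
     P \<in> carrier Y \<rightarrow> carrier X \<and> P' \<in> carrier Y \<rightarrow> carrier Z \<and>
     sg_quotient (sandwich X (carrier Y) P) (theta (sandwich X (carrier Y) P))
       \<cong> sandwich Z (carrier Y) P'"

end

theory Submission
  imports Defs
begin

text \<open>
  For \<open>M = \<M>(A \<times> B; A; P\<^sub>A)\<close>, two elements \<open>((a, b), c)\<close> and \<open>((a', b'), c')\<close> are
  \<open>\<theta>\<^sub>M\<close>-related iff \<open>c = c'\<close>, \<open>x z a = x z a'\<close> and \<open>y \<phi>(z) b = y \<phi>(z) b'\<close> for all \<open>x\<close>, \<open>y\<close>, \<open>z\<close>.  The
  second condition says that \<open>a\<close> and \<open>a'\<close> are \<open>\<theta>\<^sub>A\<^sup>*\<close>-related, the third that \<open>b\<close> and \<open>b'\<close> are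
  \<open>\<alpha>\<^sub>\<phi>\<close>-related.  So \<open>\<theta>\<^sub>M\<close> is the kernel of the surjective homomorphism
  \<open>((a, b), c) \<mapsto> (([a], [b]), c)\<close>.
\<close>

lemma sg_congruence_equiv: "sg_congruence S \<rho> \<Longrightarrow> equiv (carrier S) \<rho>"
  by (simp add: sg_congruence_def)

text \<open>The factors are replaced one at a time, passing through \<open>b \<otimes> c\<close>,
  since \<open>sg_congruence\<close> only multiplies by a fixed element.\<close>

lemma sg_congruence_mult:
  assumes "sg_congruence S \<rho>" "(a, b) \<in> \<rho>" "(c, d) \<in> \<rho>"
  shows "(a \<otimes>\<^bsub>S\<^esub> c, b \<otimes>\<^bsub>S\<^esub> d) \<in> \<rho>"
proof -
  have eq: "equiv (carrier S) \<rho>"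
    using assms(1) by (rule sg_congruence_equiv)
  have "b \<in> carrier S" "c \<in> carrier S"
    using assms(2,3) equiv_type[OF eq] by auto
  then have "(a \<otimes>\<^bsub>S\<^esub> c, b \<otimes>\<^bsub>S\<^esub> c) \<in> \<rho>" "(b \<otimes>\<^bsub>S\<^esub> c, b \<otimes>\<^bsub>S\<^esub> d) \<in> \<rho>"
    using assms unfolding sg_congruence_def by blast+
  then show ?thesis
    using eq by (meson equivE transE)
qed

lemma sg_quotient_mult:
  assumes "sg_congruence S \<rho>" "a \<in> carrier S" "b \<in> carrier S"
  shows "\<rho> `` {a} \<otimes>\<^bsub>sg_quotient S \<rho>\<^esub> \<rho> `` {b} = \<rho> `` {a \<otimes>\<^bsub>S\<^esub> b}"
proof -
  have eq: "equiv (carrier S) \<rho>"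
    using assms(1) by (rule sg_congruence_equiv)
  have "\<rho> `` {x \<otimes>\<^bsub>S\<^esub> y} = \<rho> `` {a \<otimes>\<^bsub>S\<^esub> b}" if "x \<in> \<rho> `` {a}" "y \<in> \<rho> `` {b}" for x y
    using that sg_congruence_mult[OF assms(1), of a x b y] equiv_class_eq[OF eq] by auto
  \<comment> \<open>All members of the union coincide; this makes it range over nonempty sets, so
    that it is that common class and not the empty set.\<close>
  moreover have "a \<in> \<rho> `` {a}" "b \<in> \<rho> `` {b}"
    using equiv_class_self[OF eq] assms(2,3) by auto
  ultimately have "(\<Union>x\<in>\<rho> `` {a}. \<Union>y\<in>\<rho> `` {b}. \<rho> `` {x \<otimes>\<^bsub>S\<^esub> y}) = \<rho> `` {a \<otimes>\<^bsub>S\<^esub> b}"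
    by blast
  then show ?thesis
    by (simp add: sg_quotient_def)
qed

lemma sg_quotient_carrier: "carrier (sg_quotient S \<rho>) = carrier S // \<rho>"
  by (simp add: sg_quotient_def)

lemma nonempty_semigroup_sg_quotient:
  assumes "nonempty_semigroup S" "sg_congruence S \<rho>"
  shows "nonempty_semigroup (sg_quotient S \<rho>)"
proof -
  interpret nonempty_semigroup S by fact
  show ?thesis
  proof
    show "carrier (sg_quotient S \<rho>) \<noteq> {}"
      using carrier_nonempty by (auto simp: sg_quotient_carrier quotient_def)
  qed (auto simp: sg_quotient_carrier sg_quotient_mult[OF assms(2)] m_closed m_assoc
         intro!: quotientI elim!: quotientE)
qed

lemma nonempty_semigroup_DirProd:
  assumes "nonempty_semigroup S" "nonempty_semigroup T"
  shows "nonempty_semigroup (S \<times>\<times> T)"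
proof -
  interpret S: nonempty_semigroup S by fact
  interpret T: nonempty_semigroup T by fact
  show ?thesis
    by unfold_locales
      (auto simp: S.carrier_nonempty T.carrier_nonempty S.m_closed T.m_closed S.m_assoc T.m_assoc)
qed

text \<open>First isomorphism theorem for semigroups: the kernel of a homomorphism is a congruence,
  and \<open>f\<close> factors through its classes.\<close>

lemma sg_quotient_iso:
  assumes S: "nonempty_semigroup S"
    and hom: "f \<in> hom S T"
    and surj: "f ` carrier S = carrier T"
    and ker: "\<rho> = {(a, b) \<in> carrier S \<times> carrier S. f a = f b}"
  shows "sg_quotient S \<rho> \<cong> T"
proof -
  interpret nonempty_semigroup S by fact
  have eq: "equiv (carrier S) \<rho>"
    unfolding ker by (auto intro!: equivI refl_onI symI transI)
  have cong: "sg_congruence S \<rho>"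
    unfolding sg_congruence_def using eq hom by (auto simp: ker hom_def m_closed)
  \<comment> \<open>\<open>f\<close> is constant on each class, so the image of a class is a
    singleton and \<open>the_elem\<close> returns its one value.\<close>
  define g where "g X = the_elem (f ` X)" for X
  have g: "g (\<rho> `` {a}) = f a" if "a \<in> carrier S" for a
  proof -
    have "f ` (\<rho> `` {a}) = {f a}"
      using that by (auto simp: ker)
    then show ?thesis by (simp add: g_def)
  qed
  have "g \<in> hom (sg_quotient S \<rho>) T"
    using hom by (auto simp: hom_def sg_quotient_carrier sg_quotient_mult[OF cong] g m_closed
        elim!: quotientE)
  moreover have "inj_on g (carrier (sg_quotient S \<rho>))"
  proof (rule inj_onI)
    fix X Y assume "X \<in> carrier (sg_quotient S \<rho>)" "Y \<in> carrier (sg_quotient S \<rho>)" "g X = g Y"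
    then obtain a b where "X = \<rho> `` {a}" "Y = \<rho> `` {b}" "a \<in> carrier S" "b \<in> carrier S" "f a = f b"
      by (auto simp: sg_quotient_carrier g elim!: quotientE)
    then show "X = Y"
      by (auto simp: ker)
  qed
  moreover have "g ` carrier (sg_quotient S \<rho>) = carrier T"
  proof -
    have "g ` (carrier S // \<rho>) = f ` carrier S"
      by (auto simp: quotient_def g image_iff)
    then show ?thesis by (simp add: sg_quotient_carrier surj)
  qed
  ultimately show ?thesis
    unfolding is_iso_def iso_def bij_betw_def by blast
qed

lemma nonempty_semigroup_sandwich:
  assumes "nonempty_semigroup S" "\<Lambda> \<noteq> {}" "P \<in> \<Lambda> \<rightarrow> carrier S"
  shows "nonempty_semigroup (sandwich S \<Lambda> P)"
proof -
  interpret nonempty_semigroup S by fact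
  have "P l \<in> carrier S" if "l \<in> \<Lambda>" for l
    using that assms(3) by auto
  then show ?thesis
    using assms(2)
    by unfold_locales (auto simp: sandwich_def carrier_nonempty m_closed m_assoc)
qed

text \<open>Left compatibility holds because x(sa) = (xs)a and xs is again a test element; right
  compatibility comes from multiplying xa = xb by s.\<close>

lemma sg_congruence_theta:
  assumes "nonempty_semigroup S"
  shows "sg_congruence S (theta S)"
proof -
  interpret nonempty_semigroup S by fact
  have "equiv (carrier S) (theta S)"
    by (auto simp: theta_def intro!: equivI refl_onI symI transI)
  then show ?thesis
    by (auto simp: sg_congruence_def theta_def m_closed m_assoc[symmetric])
qed

text \<open>Again t(sa) = (ts)a gives the left side; on the right, t(as) = (ta)s reduces to right
  compatibility of \<open>\<rho>\<close>.\<close>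

lemma sg_congruence_right_colon:
  assumes "nonempty_semigroup S" "sg_congruence S \<rho>"
  shows "sg_congruence S (right_colon S \<rho>)"
proof -
  interpret nonempty_semigroup S by fact
  have eq: "equiv (carrier S) \<rho>"
    using assms(2) by (rule sg_congruence_equiv)
  have refl: "(a, a) \<in> \<rho>" if "a \<in> carrier S" for a
    using eq that by (simp add: equiv_def refl_on_def)
  have "sym \<rho>" "trans \<rho>"
    using eq by (auto elim: equivE)
  then have "equiv (carrier S) (right_colon S \<rho>)"
    by (intro equivI refl_onI symI transI)
      (auto simp: right_colon_def m_closed refl dest: symD transD)
  then show ?thesis
    using assms(2)
    by (auto simp: sg_congruence_def right_colon_def m_closed m_assoc[symmetric])
qed

theorem theorem8:
  fixes A :: "('a, 'm) monoid_scheme"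
    and B :: "('b, 'n) monoid_scheme"
    and \<phi> :: "'a \<Rightarrow> 'b"
  assumes "nonempty_semigroup A"
    and "nonempty_semigroup B"
    and "\<phi> \<in> carrier A \<rightarrow> carrier B"
    and "sg_congruence B (alpha (carrier A) B \<phi>)"
  shows "right_regular
    (A \<times>\<times> B)
    A
    (sg_quotient A (right_colon A (theta A)) \<times>\<times> sg_quotient B (alpha (carrier A) B \<phi>))
    (\<lambda>a. (a, \<phi> a))
    (\<lambda>a. (right_colon A (theta A) `` {a}, alpha (carrier A) B \<phi> `` {\<phi> a}))"
proof -
  interpret A: nonempty_semigroup A by fact
  interpret B: nonempty_semigroup B by fact
  define \<rho> where "\<rho> = right_colon A (theta A)"
  define \<sigma> where "\<sigma> = alpha (carrier A) B \<phi>"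
  define M where "M = sandwich (A \<times>\<times> B) (carrier A) (\<lambda>a. (a, \<phi> a))"
  define N where "N = sandwich (sg_quotient A \<rho> \<times>\<times> sg_quotient B \<sigma>) (carrier A)
    (\<lambda>a. (\<rho> `` {a}, \<sigma> `` {\<phi> a}))"
  define f where "f = (\<lambda>((a, b), c :: 'a). ((\<rho> `` {a}, \<sigma> `` {b}), c))"
  have \<phi>: "\<phi> a \<in> carrier B" if "a \<in> carrier A" for a
    using that assms(3) by auto
  have \<rho>: "sg_congruence A \<rho>"
    unfolding \<rho>_def by (intro sg_congruence_right_colon sg_congruence_theta assms(1))
  \<comment> \<open>In general \<alpha> is only a right congruence, so its left compatibility has to
    come from the hypothesis, whereas \<open>\<rho>\<close> is a congruence for every
    semigroup.\<close>
  have \<sigma>: "sg_congruence B \<sigma>"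
    unfolding \<sigma>_def by fact
  note quot = sg_quotient_carrier sg_quotient_mult[OF \<rho>] sg_quotient_mult[OF \<sigma>]
  have AB: "nonempty_semigroup (A \<times>\<times> B)"
    by (intro nonempty_semigroup_DirProd assms)
  have P: "(\<lambda>a. (a, \<phi> a)) \<in> carrier A \<rightarrow> carrier (A \<times>\<times> B)"
    using \<phi> by auto
  have "nonempty_semigroup M"
    unfolding M_def using AB A.carrier_nonempty P by (rule nonempty_semigroup_sandwich)
  \<comment> \<open>The sandwich map of \<open>N\<close> is that of \<open>M\<close> followed by the
    two class maps, so \<open>f\<close> carries the inserted middle factor of a product in
    \<open>M\<close> to the one in \<open>N\<close>.\<close>
  moreover have "f \<in> hom M N"
    by (auto simp: hom_def f_def M_def N_def sandwich_def quot \<phi> A.m_closed B.m_closed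
        intro: quotientI)
  moreover have "f ` carrier M = carrier N"
  proof
    show "f ` carrier M \<subseteq> carrier N"
      using \<open>f \<in> hom M N\<close> by (auto simp: hom_def)
    show "carrier N \<subseteq> f ` carrier M"
    proof
      fix n assume "n \<in> carrier N"
      then obtain a b c where "n = f ((a, b), c)" "((a, b), c) \<in> carrier M"
        by (auto simp: N_def M_def sandwich_def quot f_def elim!: quotientE)
      then show "n \<in> f ` carrier M" by blast
    qed
  qed
  moreover have "theta M = {(u, v) \<in> carrier M \<times> carrier M. f u = f v}"
  proof -
    have \<rho>_iff: "\<rho> `` {a} = \<rho> `` {a'} \<longleftrightarrow>
        (\<forall>x \<in> carrier A. \<forall>z \<in> carrier A. x \<otimes>\<^bsub>A\<^esub> z \<otimes>\<^bsub>A\<^esub> a = x \<otimes>\<^bsub>A\<^esub> z \<otimes>\<^bsub>A\<^esub> a')"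
      if "a \<in> carrier A" "a' \<in> carrier A" for a a'
      using that eq_equiv_class_iff[OF sg_congruence_equiv[OF \<rho>] that]
      by (auto simp: \<rho>_def right_colon_def theta_def A.m_closed A.m_assoc)
    have \<sigma>_iff: "\<sigma> `` {b} = \<sigma> `` {b'} \<longleftrightarrow>
        (\<forall>y \<in> carrier B. \<forall>z \<in> carrier A. y \<otimes>\<^bsub>B\<^esub> \<phi> z \<otimes>\<^bsub>B\<^esub> b = y \<otimes>\<^bsub>B\<^esub> \<phi> z \<otimes>\<^bsub>B\<^esub> b')"
      if "b \<in> carrier B" "b' \<in> carrier B" for b b'
      using that eq_equiv_class_iff[OF sg_congruence_equiv[OF \<sigma>] that]
      by (auto simp: \<sigma>_def alpha_def)
    have "(u, v) \<in> theta M \<longleftrightarrow> f u = f v" if uv: "u \<in> carrier M" "v \<in> carrier M" for u v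
    proof -
      obtain a b c where u: "u = ((a, b), c)" by (metis surj_pair)
      obtain a' b' c' where v: "v = ((a', b'), c')" by (metis surj_pair)
      show ?thesis
        \<comment> \<open>Multiplying on the left by \<open>((x, y), z)\<close> gives
          \<open>((x z a, y \<phi>(z) b), c)\<close>. The equations in A and B are quantified
          jointly over x and y; nonempty carriers let them be separated, and supply a multiplier
          from which \<open>c = c'\<close> is read off.\<close>
        using uv A.carrier_nonempty B.carrier_nonempty
        by (auto simp: u v theta_def f_def M_def sandwich_def \<rho>_iff \<sigma>_iff)
    qed
    moreover have "theta M \<subseteq> carrier M \<times> carrier M"
      by (auto simp: theta_def)
    ultimately show ?thesis by blast
  qed
  ultimately have "sg_quotient M (theta M) \<cong> N"
    by (rule sg_quotient_iso)
  \<comment> \<open>With the isomorphism in hand, only the typing conditions on the third semigroup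
    and on P' are left.\<close>
  moreover have "nonempty_semigroup (sg_quotient A \<rho> \<times>\<times> sg_quotient B \<sigma>)"
    by (intro nonempty_semigroup_DirProd nonempty_semigroup_sg_quotient assms(1,2) \<rho> \<sigma>)
  moreover have "(\<lambda>a. (\<rho> `` {a}, \<sigma> `` {\<phi> a}))
      \<in> carrier A \<rightarrow> carrier (sg_quotient A \<rho> \<times>\<times> sg_quotient B \<sigma>)"
    using \<phi> by (auto simp: quot intro: quotientI)
  ultimately show ?thesis
    using AB P assms(1) unfolding right_regular_def M_def N_def \<rho>_def \<sigma>_def by blast
qed

end
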